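(* Let $\mathcal M=(M,\rho)$ be a five-point metric space, $M=\{p_1,\dots,p_5\}$, $d_{ij}=\rho(p_i,p_j)$. Let $G$ be the binary tree with boundary $M$ whose moustaches are the pairs $\{p_1,p_2\}$ and $\{p_4,p_5\}$ (the remaining boundary vertex being $p_3$). Then the polyhedral set $\Lambda_G$ is a $3$-dimensional tetrahedron in $\mathbb R^{10}$ with the vertices (coordinates $\lambda_{ij}$, $i<j$, ordered lexicographically) $$\tfrac12(1,0,0,1,1,0,0,1,0,1),\quad \tfrac12(1,1,0,0,0,0,1,1,0,1),\quad \tfrac12(1,0,1,0,1,0,0,0,1,1),\quad \tfrac12(1,1,0,0,0,1,0,0,1,1),$$ and the weight $\mathrm{mpf}_{-}(\mathcal M,G)$ of the generalized minimal parametric filling of type $G$ of $\mathcal M$ is equal to the maximum of the four values $$\tfrac12(d_{12}+d_{15}+d_{23}+d_{34}+d_{45}),\quad \tfrac12(d_{12}+d_{13}+d_{25}+d_{34}+d_{45}),$$ $$\tfrac12(d_{12}+d_{14}+d_{23}+d_{35}+d_{45}),\quad \tfrac12(d_{12}+d_{13}+d_{24}+d_{35}+d_{45}).$$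
   Context: A binary tree is a finite tree all of whose vertices have degree $1$ or $3$; its boundary is the set of all its vertices of degree $1$. Moustaches of a binary tree are a pair of boundary vertices having a common neighbouring vertex. Let $G=(V,E)$ be a binary tree with boundary $M=\{p_1,\dots,p_n\}$. For $i<j$ let $\gamma(i,j)$ denote the unique path in $G$ joining $p_i$ and $p_j$. A function $\omega\colon E\to\mathbb R$ (negative values allowed) makes $G$ a generalized filling of $\mathcal M$ if $\sum_{e\in\gamma(i,j)}\omega(e)\ge d_{ij}$ for all $1\le i<j\le n$. Then $\mathrm{mpf}_{-}(\mathcal M,G)$ is the infimum of $\sum_{e\in E}\omega(e)$ over all such $\omega$. Each edge $e\in E$ generates a partition $\mathcal P_G(e)=\{M_1,M_2\}$ of $M$, where $M_1,M_2$ are the sets of elements of $M$ lying in the two connected components obtained by deleting $e$ from $G$. The set $\Lambda_G\subset\mathbb R^{n(n-1)/2}$ consists of all vectors $\lambda=(\lambda_{ij})_{1\le i<j\le n}$ with $\lambda_{ij}\ge0$ and, for every $e\in E$, $\sum\lambda_{ij}=1$, where the sum is over all $i<j$ such that $p_i$ and $p_j$ lie in different elements of $\mathcal P_G(e)$. *)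

theory Defs
  imports "HOL-Analysis.Analysis"
begin

text \<open>A graph is given by its vertex set \<open>V\<close> and its set \<open>E\<close> of edges, an edge being the
  two-element set of its ends.  (An undirected tree is not a \<open>tree\<close> of the AFP entry Graph Theory:
  there a pair of opposite arcs is a cycle.)\<close>

definition simple_graph :: "'v set \<Rightarrow> 'v set set \<Rightarrow> bool" where
  "simple_graph V E \<longleftrightarrow> (\<forall>e\<in>E. e \<subseteq> V \<and> card e = 2)"

definition degree_of :: "'v set set \<Rightarrow> 'v \<Rightarrow> nat" where
  "degree_of E v = card {e \<in> E. v \<in> e}"

definition path_edges :: "'v list \<Rightarrow> 'v set set" where
  "path_edges xs = {{xs ! k, xs ! Suc k} | k. Suc k < length xs}"

definition graph_path :: "'v set \<Rightarrow> 'v set set \<Rightarrow> 'v \<Rightarrow> 'v list \<Rightarrow> 'v \<Rightarrow> bool" where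
  "graph_path V E u xs v \<longleftrightarrow>
     xs \<noteq> [] \<and> distinct xs \<and> set xs \<subseteq> V \<and> path_edges xs \<subseteq> E \<and> hd xs = u \<and> last xs = v"

definition graph_connected :: "'v set \<Rightarrow> 'v set set \<Rightarrow> bool" where
  "graph_connected V E \<longleftrightarrow> V \<noteq> {} \<and> (\<forall>u\<in>V. \<forall>v\<in>V. \<exists>xs. graph_path V E u xs v)"

definition graph_components :: "'v set \<Rightarrow> 'v set set \<Rightarrow> 'v set set" where
  "graph_components V E = {{v \<in> V. \<exists>xs. graph_path V E u xs v} | u. u \<in> V}"

definition graph_cycle :: "'v set \<Rightarrow> 'v set set \<Rightarrow> 'v list \<Rightarrow> bool" where
  "graph_cycle V E xs \<longleftrightarrow>
     3 \<le> length xs \<and> distinct xs \<and> set xs \<subseteq> V \<and> path_edges xs \<subseteq> E \<and> {last xs, hd xs} \<in> E"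

definition is_tree :: "'v set \<Rightarrow> 'v set set \<Rightarrow> bool" where
  "is_tree V E \<longleftrightarrow> simple_graph V E \<and> graph_connected V E \<and> \<not> (\<exists>xs. graph_cycle V E xs)"

definition binary_tree :: "'v set \<Rightarrow> 'v set set \<Rightarrow> bool" where
  "binary_tree V E \<longleftrightarrow> finite V \<and> is_tree V E \<and> (\<forall>v\<in>V. degree_of E v = 1 \<or> degree_of E v = 3)"

definition tree_boundary :: "'v set \<Rightarrow> 'v set set \<Rightarrow> 'v set" where
  "tree_boundary V E = {v \<in> V. degree_of E v = 1}"

definition moustaches :: "'v set \<Rightarrow> 'v set set \<Rightarrow> 'v set set" where
  "moustaches V E = {{x, y} | x y. x \<in> tree_boundary V E \<and> y \<in> tree_boundary V E \<and> x \<noteq> y \<and>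
     (\<exists>z\<in>V. {x, z} \<in> E \<and> {y, z} \<in> E)}"

definition tree_path :: "'v set \<Rightarrow> 'v set set \<Rightarrow> 'v \<Rightarrow> 'v \<Rightarrow> 'v list" where
  "tree_path V E u v = (THE xs. graph_path V E u xs v)"

text \<open>In the following, the boundary points are \<open>p 1, \<dots>, p n\<close>.\<close>

definition index_pairs :: "nat \<Rightarrow> (nat \<times> nat) set" where
  "index_pairs n = {(i, j). 1 \<le> i \<and> i < j \<and> j \<le> n}"

definition generalized_filling ::
    "nat \<Rightarrow> (nat \<Rightarrow> 'v) \<Rightarrow> ('v \<Rightarrow> 'v \<Rightarrow> real) \<Rightarrow> 'v set \<Rightarrow> 'v set set \<Rightarrow> ('v set \<Rightarrow> real) \<Rightarrow> bool" where
  "generalized_filling n p \<rho> V E \<omega> \<longleftrightarrow>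
     (\<forall>(i, j)\<in>index_pairs n. (\<Sum>e\<in>path_edges (tree_path V E (p i) (p j)). \<omega> e) \<ge> \<rho> (p i) (p j))"

text \<open>The infimum is taken in the extended reals, so that an unbounded problem would have value
  \<open>-\<infinity>\<close> rather than an arbitrary real value.\<close>

definition mpf_minus ::
    "nat \<Rightarrow> (nat \<Rightarrow> 'v) \<Rightarrow> ('v \<Rightarrow> 'v \<Rightarrow> real) \<Rightarrow> 'v set \<Rightarrow> 'v set set \<Rightarrow> ereal" where
  "mpf_minus n p \<rho> V E = (INF \<omega>\<in>{\<omega>. generalized_filling n p \<rho> V E \<omega>}. ereal (\<Sum>e\<in>E. \<omega> e))"

definition edge_partition :: "'v set \<Rightarrow> 'v set set \<Rightarrow> 'v set \<Rightarrow> 'v set set" where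
  "edge_partition V E e = {tree_boundary V E \<inter> C | C. C \<in> graph_components V (E - {e})}"

definition separated_by :: "'v set \<Rightarrow> 'v set set \<Rightarrow> 'v set \<Rightarrow> 'v \<Rightarrow> 'v \<Rightarrow> bool" where
  "separated_by V E e x y \<longleftrightarrow>
     (\<exists>A\<in>edge_partition V E e. \<exists>B\<in>edge_partition V E e. A \<noteq> B \<and> x \<in> A \<and> y \<in> B)"

definition lex_pairs :: "nat \<Rightarrow> (nat \<times> nat) list" where
  "lex_pairs n = concat (map (\<lambda>i. map (\<lambda>j. (i, j)) [Suc i..<Suc n]) [1..<Suc n])"

lemma lex_pairs_5:
  "lex_pairs 5 = [(1,2), (1,3), (1,4), (1,5), (2,3), (2,4), (2,5), (3,4), (3,5), (4,5)]"
  by (simp add: lex_pairs_def upt_rec)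

text \<open>The set \<open>\<Lambda>\<^sub>G\<close> for five boundary points: a family \<open>(\<lambda>\<^sub>i\<^sub>j)\<close> with \<open>i < j\<close> is
  identified with the vector of its entries in lexicographic order, a point of \<open>real ^ 10\<close>.\<close>

definition Lambda5 :: "(nat \<Rightarrow> 'v) \<Rightarrow> 'v set \<Rightarrow> 'v set set \<Rightarrow> (real ^ 10) set" where
  "Lambda5 p V E = {vector (map l (lex_pairs 5)) | l :: nat \<times> nat \<Rightarrow> real.
     (\<forall>(i, j)\<in>index_pairs 5. 0 \<le> l (i, j)) \<and>
     (\<forall>e\<in>E. (\<Sum>(i, j) | (i, j) \<in> index_pairs 5 \<and> separated_by V E e (p i) (p j). l (i, j)) = 1)}"

end

theory Submission
  imports Defs
begin

text \<open>
  The number \<open>mpf\<^sub>-(\<M>, G)\<close> is the value of a linear program with one variable for each edge and one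
  inequality for each pair of boundary points, and \<open>\<Lambda>\<^sub>G\<close> is the feasible set of the dual program: an
  edge lies on the path from \<open>p\<^sub>i\<close> to \<open>p\<^sub>j\<close> exactly when deleting it separates \<open>p\<^sub>i\<close> from \<open>p\<^sub>j\<close>
  (\<open>separated_by_iff_mem_path_edges\<close>).  So the value is the maximum of \<open>\<Sum>\<lambda>\<^sub>i\<^sub>j d\<^sub>i\<^sub>j\<close> over the vertices of
  \<open>\<Lambda>\<^sub>G\<close>.

  The tree has to be found first.  In an acyclic graph there are fewer edges than vertices, whence a
  binary tree with five leaves has at most three inner vertices.  The two moustaches have different
  inner vertices \<open>a\<close> and \<open>c\<close>, which cannot be adjacent because \<open>p\<^sub>3\<close> must be connected to them; the
  third inner vertex \<open>b\<close> is therefore adjacent to \<open>a\<close>, \<open>c\<close> and \<open>p\<^sub>3\<close>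
  (\<open>binary_tree_two_moustaches\<close>).  All paths can now be listed.

  The seven equations that define \<open>\<Lambda>\<^sub>G\<close> force \<open>\<lambda>\<^sub>1\<^sub>2 = \<lambda>\<^sub>4\<^sub>5 = 1/2\<close> and express everything else
  through \<open>\<lambda>\<^sub>1\<^sub>4, \<lambda>\<^sub>1\<^sub>5, \<lambda>\<^sub>2\<^sub>4, \<lambda>\<^sub>2\<^sub>5\<close>, which are nonnegative numbers with sum \<open>1/2\<close> and
  otherwise arbitrary.  Hence \<open>\<Lambda>\<^sub>G\<close> is a tetrahedron, and at each of its vertices exactly one of these
  four numbers is nonzero (\<open>Lambda5_eq_convex_hull\<close>).  Each vertex gives a lower bound for the weight
  of a filling; conversely, there is an explicit filling whose weight is the largest of the four bounds
  (\<open>mpf_minus_eq_Max\<close>).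
\<close>

section \<open>Paths and cycles in graphs\<close>

lemma path_edges_simps [simp]:
  "path_edges [] = {}"
  "path_edges [x] = {}"
  "path_edges (x # y # zs) = insert {x, y} (path_edges (y # zs))"
proof -
  have ex_nat: "(\<exists>k. P k) \<longleftrightarrow> P 0 \<or> (\<exists>k. P (Suc k))" for P :: "nat \<Rightarrow> bool"
    by (metis not0_implies_Suc)
  show "path_edges (x # y # zs) = insert {x, y} (path_edges (y # zs))" (is "?L = ?R")
  proof (rule set_eqI)
    fix e
    have "e \<in> ?L \<longleftrightarrow> (\<exists>k. e = {(x # y # zs) ! k, (y # zs) ! k} \<and> k < Suc (length zs))"
      by (simp add: path_edges_def)
    also have "\<dots> \<longleftrightarrow> e = {x, y} \<or> (\<exists>k. e = {(y # zs) ! k, zs ! k} \<and> k < length zs)"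
      by (subst ex_nat) auto
    also have "\<dots> \<longleftrightarrow> e \<in> ?R"
      by (simp add: path_edges_def)
    finally show "e \<in> ?L \<longleftrightarrow> e \<in> ?R" .
  qed
qed (simp_all add: path_edges_def)

lemma path_edges_append_Cons:
  "path_edges (xs @ z # ys) = path_edges (xs @ [z]) \<union> path_edges (z # ys)"
proof (induction xs)
  case (Cons x xs)
  then show ?case by (cases xs) auto
qed simp

lemma path_edges_rev [simp]: "path_edges (rev xs) = path_edges xs"
proof (induction xs)
  case (Cons x xs)
  show ?case
  proof (cases xs)
    case (Cons y ys)
    then have "path_edges (rev (x # xs)) = path_edges (rev ys @ [y]) \<union> path_edges [y, x]"
      using path_edges_append_Cons[of "rev ys" y "[x]"] by simp
    also have "path_edges (rev ys @ [y]) = path_edges xs"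
      using Cons.IH \<open>xs = y # ys\<close> by simp
    finally show ?thesis
      using \<open>xs = y # ys\<close> by (simp add: insert_commute)
  qed simp
qed simp

lemma graph_path_single [simp]: "graph_path V E u [x] v \<longleftrightarrow> x = u \<and> v = u \<and> u \<in> V"
  by (auto simp: graph_path_def)

text \<open>Removing the start from the vertex set encodes that a path does not return to it.  Inductions over
  paths follow this recursion, and it reduces the check of an explicit path to disequalities.\<close>

lemma graph_path_Cons_Cons [simp]:
  "graph_path V E u (x # y # zs) v \<longleftrightarrow>
     x = u \<and> u \<in> V \<and> {u, y} \<in> E \<and> graph_path (V - {u}) E y (y # zs) v"
  by (auto simp: graph_path_def)

lemma graph_path_mono: "graph_path V E u xs v \<Longrightarrow> V \<subseteq> W \<Longrightarrow> E \<subseteq> F \<Longrightarrow> graph_path W F u xs v"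
  by (auto simp: graph_path_def)

lemma graph_cycle_mono: "graph_cycle V E cs \<Longrightarrow> V \<subseteq> W \<Longrightarrow> E \<subseteq> F \<Longrightarrow> graph_cycle W F cs"
  by (auto simp: graph_cycle_def)

lemma graph_path_sym: "graph_path V E u xs v \<Longrightarrow> graph_path V E v (rev xs) u"
  by (auto simp: graph_path_def hd_rev last_rev)

text \<open>Plain concatenation could repeat vertices; the first path is left where it first meets the
  second.\<close>

lemma graph_path_trans:
  assumes "graph_path V E u xs v" and "graph_path V E v ys w"
  shows "\<exists>zs. graph_path V E u zs w"
proof -
  have "v \<in> set xs" "v \<in> set ys"
    using assms by (auto simp: graph_path_def dest: last_in_set hd_in_set)
  then have "\<exists>x\<in>set xs. x \<in> set ys" by blast
  then obtain xs1 z xs2 where xs: "xs = xs1 @ z # xs2" and z: "z \<in> set ys"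
    and xs1: "\<forall>x\<in>set xs1. x \<notin> set ys"
    using split_list_first_prop[of xs "\<lambda>x. x \<in> set ys"] by blast
  from z obtain ys1 ys2 where ys: "ys = ys1 @ z # ys2"
    by (meson split_list)
  have "graph_path V E u (xs1 @ z # ys2) w"
    unfolding graph_path_def
  proof (intro conjI)
    show "path_edges (xs1 @ z # ys2) \<subseteq> E"
      using assms path_edges_append_Cons[of xs1 z xs2] path_edges_append_Cons[of xs1 z ys2]
        path_edges_append_Cons[of ys1 z ys2]
      unfolding xs ys graph_path_def by blast
    show "hd (xs1 @ z # ys2) = u"
      using assms(1) unfolding xs graph_path_def by (cases xs1) auto
  qed (use assms xs1 in \<open>auto simp: xs ys graph_path_def\<close>)
  then show ?thesis by blast
qed

lemma graph_path_unique:
  assumes "\<nexists>cs. graph_cycle V E cs"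
    and "graph_path V E u xs v" and "graph_path V E u ys v"
  shows "xs = ys"
  using assms
proof (induction xs arbitrary: V u ys)
  case Nil
  then show ?case by (simp add: graph_path_def)
next
  case (Cons x xs)
  show ?case
  proof (cases xs)
    case Nil
    then have "hd ys = last ys" "distinct ys" "ys \<noteq> []" "hd ys = x"
      using Cons.prems by (auto simp: graph_path_def)
    then show ?thesis
      using Nil by (cases ys) (auto split: if_splits)
  next
    case xs: (Cons x1 xs')
    have u: "u \<in> V" and ux1: "{u, x1} \<in> E" and px: "graph_path (V - {u}) E x1 xs v" and "x = u"
      using Cons.prems(2) unfolding xs by auto
    have "v \<noteq> u"
      using px last_in_set[of xs] unfolding graph_path_def by blast
    obtain y1 ys' where ys: "ys = u # y1 # ys'"
    proof -
      have "ys \<noteq> []" "hd ys = u" "last ys = v"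
        using Cons.prems(3) by (auto simp: graph_path_def)
      moreover from this have "ys \<noteq> [u]"
        using \<open>v \<noteq> u\<close> by (metis last_ConsL)
      ultimately show ?thesis
        using that by (metis list.collapse)
    qed
    have uy1: "{u, y1} \<in> E" and py: "graph_path (V - {u}) E y1 (y1 # ys') v"
      using Cons.prems(3) unfolding ys by auto
    \<comment> \<open>Branches that part at \<open>u\<close> would meet again away from \<open>u\<close> and close a cycle.\<close>
    have "x1 = y1"
    proof (rule ccontr)
      assume "x1 \<noteq> y1"
      from graph_path_trans[OF px graph_path_sym[OF py]]
      obtain zs where zs: "graph_path (V - {u}) E x1 zs y1" by blast
      then obtain z zs' where zs': "zs = x1 # z # zs'"
        using \<open>x1 \<noteq> y1\<close> unfolding graph_path_def by (metis last_ConsL list.collapse)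
      have "graph_cycle V E (u # zs)"
        using zs u ux1 uy1 unfolding zs' graph_cycle_def graph_path_def
        by (auto simp: insert_commute)
      then show False
        using Cons.prems(1) by blast
    qed
    moreover have "\<nexists>cs. graph_cycle (V - {u}) E cs"
      using Cons.prems(1) graph_cycle_mono[of "V - {u}" E _ V E] by (meson Diff_subset order_refl)
    ultimately have "xs = y1 # ys'"
      using Cons.IH px py by blast
    then show ?thesis
      using ys \<open>x = u\<close> by simp
  qed
qed

lemma tree_path_eqI:
  assumes "is_tree V E" and "graph_path V E u xs v"
  shows "tree_path V E u v = xs"
  unfolding tree_path_def
proof (rule the_equality)
  show "ys = xs" if "graph_path V E u ys v" for ys
    using graph_path_unique[OF _ that assms(2)] assms(1) unfolding is_tree_def by blast
qed (fact assms)

lemma graph_component_eq_iff: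
  assumes "u \<in> V" "v \<in> V"
  shows "{w \<in> V. \<exists>xs. graph_path V E u xs w} = {w \<in> V. \<exists>xs. graph_path V E v xs w} \<longleftrightarrow>
    (\<exists>xs. graph_path V E u xs v)"
proof
  assume "{w \<in> V. \<exists>xs. graph_path V E u xs w} = {w \<in> V. \<exists>xs. graph_path V E v xs w}"
  moreover have "graph_path V E v [v] v"
    using assms by simp
  ultimately show "\<exists>xs. graph_path V E u xs v"
    using assms(2) by blast
next
  assume "\<exists>xs. graph_path V E u xs v"
  then obtain xs where uv: "graph_path V E u xs v" ..
  have "(\<exists>xs. graph_path V E u xs w) \<longleftrightarrow> (\<exists>xs. graph_path V E v xs w)" for w
    using graph_path_trans[OF uv] graph_path_trans[OF graph_path_sym[OF uv]] by blast
  then show "{w \<in> V. \<exists>xs. graph_path V E u xs w} = {w \<in> V. \<exists>xs. graph_path V E v xs w}"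
    by simp
qed

text \<open>Some path between \<open>x\<close> and \<open>y\<close> survives the deletion of \<open>e\<close> unless \<open>e\<close> belongs to the only path
  between them.  Therefore the equations of \<open>\<Lambda>\<^sub>G\<close> and the inequalities of a generalized filling have
  mutually transposed coefficient matrices.\<close>

lemma separated_by_iff_mem_path_edges:
  assumes tree: "is_tree V E" and x: "x \<in> tree_boundary V E" and y: "y \<in> tree_boundary V E"
  shows "separated_by V E e x y \<longleftrightarrow> e \<in> path_edges (tree_path V E x y)"
proof -
  have V: "x \<in> V" "y \<in> V"
    using x y by (auto simp: tree_boundary_def)
  define comp where "comp u = {w \<in> V. \<exists>xs. graph_path V (E - {e}) u xs w}" for u
  have comp_eq: "comp u = comp v \<longleftrightarrow> v \<in> comp u" if "u \<in> V" "v \<in> V" for u v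
    unfolding comp_def using graph_component_eq_iff[OF that] that by blast
  have self: "u \<in> comp u" if "u \<in> V" for u
    using comp_eq[OF that that] by simp
  have edge_partition: "edge_partition V E e = {tree_boundary V E \<inter> comp u | u. u \<in> V}"
    unfolding edge_partition_def graph_components_def comp_def by blast
  have block: "tree_boundary V E \<inter> comp u = tree_boundary V E \<inter> comp z"
    if "u \<in> V" "z \<in> V" "z \<in> comp u" for u z
    using comp_eq that by metis
  have "separated_by V E e x y \<longleftrightarrow> y \<notin> comp x"
  proof
    assume "separated_by V E e x y"
    then obtain u v where uv: "u \<in> V" "v \<in> V" "x \<in> comp u" "y \<in> comp v"
      and ne: "tree_boundary V E \<inter> comp u \<noteq> tree_boundary V E \<inter> comp v"
      unfolding separated_by_def edge_partition by auto
    show "y \<notin> comp x"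
      using ne block uv V by metis
  next
    assume "y \<notin> comp x"
    then have "tree_boundary V E \<inter> comp x \<noteq> tree_boundary V E \<inter> comp y"
      using self[OF V(2)] y by blast
    moreover have "tree_boundary V E \<inter> comp x \<in> edge_partition V E e"
      "tree_boundary V E \<inter> comp y \<in> edge_partition V E e"
      using V unfolding edge_partition by auto
    ultimately show "separated_by V E e x y"
      unfolding separated_by_def using x y self[OF V(1)] self[OF V(2)] by (meson IntI)
  qed
  also have "\<dots> \<longleftrightarrow> e \<in> path_edges (tree_path V E x y)"
  proof -
    obtain xs where xs: "graph_path V E x xs y"
      using tree V unfolding is_tree_def graph_connected_def by blast
    have "graph_path V (E - {e}) x xs y" if "y \<in> comp x"
    proof -
      from that obtain ys where ys: "graph_path V (E - {e}) x ys y"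
        unfolding comp_def by blast
      then have "graph_path V E x ys y"
        by (rule graph_path_mono) auto
      then show ?thesis
        using ys xs tree_path_eqI[OF tree] by metis
    qed
    moreover have "y \<in> comp x" if "graph_path V (E - {e}) x xs y"
      using that V unfolding comp_def by blast
    moreover have "graph_path V (E - {e}) x xs y \<longleftrightarrow> e \<notin> path_edges xs"
      using xs by (auto simp: graph_path_def)
    ultimately show ?thesis
      using tree_path_eqI[OF tree xs] by blast
  qed
  finally show ?thesis .
qed

lemma graph_connected_closed_subset:
  assumes conn: "graph_connected V E" and S: "u \<in> S" "S \<subseteq> V"
    and closed: "\<And>e. e \<in> E \<Longrightarrow> e \<inter> S \<noteq> {} \<Longrightarrow> e \<subseteq> S"
  shows "S = V"
proof -
  have "v \<in> S" if "graph_path W E u xs v" "u \<in> S" for W u v xs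
    using that
  proof (induction xs arbitrary: W u)
    case (Cons x xs)
    show ?case
    proof (cases xs)
      case (Cons y ys)
      then have "{u, y} \<in> E" "graph_path (W - {u}) E y xs v"
        using Cons.prems by auto
      moreover from this have "y \<in> S"
        using closed[of "{u, y}"] Cons.prems by auto
      ultimately show ?thesis
        using Cons.IH by blast
    qed (use Cons.prems in auto)
  qed (simp add: graph_path_def)
  then show ?thesis
    using conn S unfolding graph_connected_def by blast
qed

section \<open>Counting edges and vertices\<close>

lemma simple_graph_finite_edges:
  assumes "finite V" "simple_graph V E"
  shows "finite E"
proof (rule finite_subset)
  show "E \<subseteq> Pow V" using assms by (auto simp: simple_graph_def)
qed (use assms in simp)

text \<open>An end of a longest path will do: a neighbour off the path would prolong it, and a neighbour on
  the path other than the adjacent one would close a cycle.\<close>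

lemma acyclic_graph_has_vertex_of_degree_le_1:
  assumes fin: "finite V" and "V \<noteq> {}" and simple: "simple_graph V E"
    and acyclic: "\<nexists>cs. graph_cycle V E cs"
  shows "\<exists>v\<in>V. degree_of E v \<le> 1"
proof -
  define P where "P = {xs. xs \<noteq> [] \<and> distinct xs \<and> set xs \<subseteq> V \<and> path_edges xs \<subseteq> E}"
  have "P \<subseteq> {xs. set xs \<subseteq> V \<and> distinct xs}"
    unfolding P_def by blast
  then have "finite P"
    using finite_subset finite_subset_distinct[OF fin] by blast
  moreover obtain v where "v \<in> V" using \<open>V \<noteq> {}\<close> by blast
  then have "[v] \<in> P" unfolding P_def by simp
  ultimately have "Max (length ` P) \<in> length ` P"
    by (intro Max_in) auto
  then obtain xs where xs: "xs \<in> P" and "length xs = Max (length ` P)"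
    by (metis imageE)
  then have longest: "length ys \<le> length xs" if "ys \<in> P" for ys
    using \<open>finite P\<close> that by simp
  from xs obtain u us where us: "xs = u # us"
    unfolding P_def by (cases xs) auto
  have "u \<in> V" using xs unfolding P_def us by simp
  have "{e \<in> E. u \<in> e} \<subseteq> {{u, hd us}}"
  proof
    fix e assume "e \<in> {e \<in> E. u \<in> e}"
    then have e: "e \<in> E" "u \<in> e" "e \<subseteq> V" "card e = 2"
      using simple by (auto simp: simple_graph_def)
    then obtain z where z: "e = {u, z}" "z \<noteq> u"
      by (metis card_2_iff insertE insert_commute singletonD)
    have zV: "z \<in> V" using e z by blast
    have "z \<in> set xs"
    proof (rule ccontr)
      assume "z \<notin> set xs"
      then have "z # xs \<in> P"
        using xs e z zV unfolding P_def us by (auto simp: insert_commute)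
      then show False using longest by fastforce
    qed
    then have "z \<in> set us" using z us by simp
    then obtain ys zs where yz: "us = ys @ z # zs" by (meson split_list)
    have "ys = []"
    proof (rule ccontr)
      assume "ys \<noteq> []"
      have "graph_cycle V E (u # ys @ [z])"
        using xs e z \<open>ys \<noteq> []\<close> path_edges_append_Cons[of "u # ys" z zs]
        unfolding P_def us yz graph_cycle_def
        by (auto simp: insert_commute Suc_le_eq)
      then show False using acyclic by blast
    qed
    then show "e \<in> {{u, hd us}}" using z yz by simp
  qed
  then have "card {e \<in> E. u \<in> e} \<le> 1"
    using card_mono[of "{{u, hd us}}"] by fastforce
  then show ?thesis
    using \<open>u \<in> V\<close> unfolding degree_of_def by blast
qed

text \<open>Deleting a vertex of degree at most one removes one vertex and at most one edge.\<close>

lemma acyclic_graph_card_edges_less: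
  assumes "finite V" "V \<noteq> {}" "simple_graph V E" "\<nexists>cs. graph_cycle V E cs"
  shows "card E < card V"
  using assms
proof (induction "card V" arbitrary: V E rule: less_induct)
  case less
  obtain v where v: "v \<in> V" "degree_of E v \<le> 1"
    using acyclic_graph_has_vertex_of_degree_le_1[OF less.prems] by blast
  define W where "W = V - {v}"
  define F where "F = {e \<in> E. v \<notin> e}"
  have "finite E"
    using less.prems simple_graph_finite_edges by blast
  have card_V: "card V = Suc (card W)"
    using v less.prems(1) unfolding W_def by (metis card_Suc_Diff1)
  have simple: "simple_graph W F"
    using less.prems(3) unfolding W_def F_def simple_graph_def by blast
  have "E = F \<union> {e \<in> E. v \<in> e}" unfolding F_def by blast
  then have card_E: "card E \<le> card F + 1"
    using v(2) card_Un_le[of F "{e \<in> E. v \<in> e}"] unfolding degree_of_def by simp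
  show ?case
  proof (cases "W = {}")
    case True
    have "E = {}"
    proof (rule ccontr)
      assume "E \<noteq> {}"
      then obtain e where "e \<subseteq> V" "card e = 2"
        using less.prems(3) unfolding simple_graph_def by blast
      then have "2 \<le> card V"
        using card_mono less.prems(1) by metis
      then show False using card_V True by simp
    qed
    then show ?thesis using card_V by simp
  next
    case False
    have "\<nexists>cs. graph_cycle W F cs"
    proof
      assume "\<exists>cs. graph_cycle W F cs"
      then obtain cs where "graph_cycle W F cs" ..
      then have "graph_cycle V E cs"
        by (rule graph_cycle_mono) (auto simp: W_def F_def)
      then show False using less.prems(4) by blast
    qed
    then have "card F < card W"
      using less.hyps[of W F] card_V less.prems(1) simple False by (simp add: W_def)
    then show ?thesis using card_V card_E by simp
  qed
qed

lemma sum_degrees: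
  assumes "finite V" "simple_graph V E"
  shows "(\<Sum>v\<in>V. degree_of E v) = 2 * card E"
  unfolding degree_of_def
proof (rule sum_multicount)
  show "finite E"
    using assms by (rule simple_graph_finite_edges)
  have "{v \<in> V. v \<in> e} = e" if "e \<in> E" for e
    using that assms by (auto simp: simple_graph_def)
  then show "\<forall>e\<in>E. card {v \<in> V. v \<in> e} = 2"
    using assms by (simp add: simple_graph_def)
qed (use assms in auto)

text \<open>If there are \<open>k\<close> inner vertices and \<open>n\<close> leaves, then \<open>3 k + n\<close> is the sum of the degrees, that is,
  \<open>2 |E|\<close>, which is at most \<open>2 (k + n - 1)\<close>.\<close>

lemma binary_tree_card_inner_vertices:
  assumes "binary_tree V E"
  shows "card (V - tree_boundary V E) + 2 \<le> card (tree_boundary V E)"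
proof -
  let ?B = "tree_boundary V E"
  have fin: "finite V" and simple: "simple_graph V E" and "V \<noteq> {}"
    and acyclic: "\<nexists>cs. graph_cycle V E cs"
    using assms by (auto simp: binary_tree_def is_tree_def graph_connected_def)
  have B: "?B \<subseteq> V" by (auto simp: tree_boundary_def)
  have "(\<Sum>v\<in>V. degree_of E v) = (\<Sum>v\<in>V - ?B. degree_of E v) + (\<Sum>v\<in>?B. degree_of E v)"
    using fin B by (simp add: sum.subset_diff)
  also have "(\<Sum>v\<in>V - ?B. degree_of E v) = (\<Sum>v\<in>V - ?B. 3)"
    using assms by (intro sum.cong) (auto simp: binary_tree_def tree_boundary_def)
  also have "(\<Sum>v\<in>?B. degree_of E v) = (\<Sum>v\<in>?B. 1)"
    by (intro sum.cong) (auto simp: tree_boundary_def)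
  finally have "2 * card E = 3 * card (V - ?B) + card ?B"
    using sum_degrees[OF fin simple] by simp
  moreover have "card V = card (V - ?B) + card ?B"
    using fin B by (metis card_Diff_subset card_mono finite_subset le_add_diff_inverse2)
  moreover have "card E < card V"
    using acyclic_graph_card_edges_less fin \<open>V \<noteq> {}\<close> simple acyclic by blast
  ultimately show ?thesis by linarith
qed

section \<open>The shape of the tree\<close>

lemma doubleton_eq_card_2:
  assumes "card e = 2" "x \<in> e"
  obtains y where "y \<noteq> x" "e = {x, y}"
  using assms by (metis card_2_iff doubleton_eq_iff insertE singletonD)

text \<open>Each moustache has an inner vertex with one further neighbour.  If that neighbour were \<open>x3\<close> or the
  inner vertex of the other moustache, a proper part of the tree would already be a connected
  component.  So both further neighbours are inner vertices distinct from \<open>a\<close> and \<open>c\<close>, and the count of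
  inner vertices leaves just one candidate.\<close>

lemma binary_tree_two_moustaches:
  assumes tree: "binary_tree V E"
    and dist: "distinct [x1, x2, x3, x4, x5]"
    and bdry: "tree_boundary V E = {x1, x2, x3, x4, x5}"
    and m1: "{x1, x2} \<in> moustaches V E" and m2: "{x4, x5} \<in> moustaches V E"
  obtains a b c where "distinct [x1, x2, x3, x4, x5, a, b, c]"
    and "V = {x1, x2, x3, x4, x5, a, b, c}"
    and "E = {{x1, a}, {x2, a}, {x3, b}, {x4, c}, {x5, c}, {a, b}, {b, c}}"
proof -
  define inc where "inc v = {e \<in> E. v \<in> e}" for v
  have fin: "finite V" and conn: "graph_connected V E"
    and edge: "\<And>e. e \<in> E \<Longrightarrow> e \<subseteq> V \<and> card e = 2"
    and deg: "\<And>v. v \<in> V \<Longrightarrow> card (inc v) = 1 \<or> card (inc v) = 3"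
    using tree unfolding binary_tree_def is_tree_def simple_graph_def degree_of_def inc_def by auto
  have leaf: "x \<in> V \<and> card (inc x) = 1" if "x \<in> {x1, x2, x3, x4, x5}" for x
    using that bdry unfolding tree_boundary_def degree_of_def inc_def by blast
  have inner: "card (inc x) = 3" if "x \<in> V" "x \<notin> {x1, x2, x3, x4, x5}" for x
    using that bdry deg[of x] unfolding tree_boundary_def degree_of_def inc_def by blast
  have no_loop: "u \<noteq> v" if "{u, v} \<in> E" for u v
    using edge[OF that] by auto
  have ends: "u \<in> V" "v \<in> V" if "{u, v} \<in> E" for u v
    using edge[OF that] by auto
  have leaf_inc: "inc x = {{x, y}}" if "x \<in> {x1, x2, x3, x4, x5}" "{x, y} \<in> E" for x y
  proof -
    have "{x, y} \<in> inc x" using that(2) unfolding inc_def by simp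
    then show ?thesis using leaf[OF that(1)] by (metis card_1_singletonE singletonD)
  qed
  have leaf_nbr: "y = z" if "x \<in> {x1, x2, x3, x4, x5}" "{x, y} \<in> E" "{x, z} \<in> E" for x y z
    using leaf_inc[OF that(1,2)] leaf_inc[OF that(1,3)] by (auto simp: doubleton_eq_iff)
  have moustache: "\<exists>z w. {x, z} \<in> E \<and> {y, z} \<in> E \<and> z \<notin> {x1, x2, x3, x4, x5} \<and>
      w \<notin> {x, y, z} \<and> inc z = {{x, z}, {y, z}, {z, w}}"
    if xy: "{x, y} \<in> moustaches V E" and "x \<noteq> y" for x y
  proof -
    obtain x' y' z where "{x, y} = {x', y'}" "{x', z} \<in> E" "{y', z} \<in> E"
      using xy unfolding moustaches_def by auto
    then have z: "{x, z} \<in> E" "{y, z} \<in> E"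
      by (auto simp: doubleton_eq_iff)
    have "z \<notin> {x1, x2, x3, x4, x5}"
      using leaf_nbr[of z x y] z \<open>x \<noteq> y\<close> by (metis insert_commute)
    then have card: "card (inc z) = 3"
      using inner ends z by blast
    have sub: "{{x, z}, {y, z}} \<subseteq> inc z"
      using z unfolding inc_def by blast
    have "{x, z} \<noteq> {y, z}"
      using \<open>x \<noteq> y\<close> by (auto simp: doubleton_eq_iff)
    then have "card {{x, z}, {y, z}} = 2"
      by simp
    then have "card (inc z - {{x, z}, {y, z}}) = 1"
      using card sub by (simp add: card_Diff_subset)
    then obtain e where e: "inc z - {{x, z}, {y, z}} = {e}"
      by (meson card_1_singletonE)
    then have "e \<in> E" "z \<in> e" "e \<noteq> {x, z}" "e \<noteq> {y, z}"
      unfolding inc_def by blast+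
    then obtain w where w: "w \<noteq> z" "e = {z, w}"
      using edge doubleton_eq_card_2 by metis
    moreover have "inc z = {{x, z}, {y, z}, {z, w}}"
      using e sub w by blast
    ultimately have "w \<notin> {x, y, z} \<and> inc z = {{x, z}, {y, z}, {z, w}}"
      using \<open>e \<noteq> {x, z}\<close> \<open>e \<noteq> {y, z}\<close> by (auto simp: insert_commute)
    then show ?thesis
      using z \<open>z \<notin> {x1, x2, x3, x4, x5}\<close> by blast
  qed
  obtain a b where a: "{x1, a} \<in> E" "{x2, a} \<in> E" "a \<notin> {x1, x2, x3, x4, x5}"
    and b: "b \<notin> {x1, x2, a}" and inc_a: "inc a = {{x1, a}, {x2, a}, {a, b}}"
    using moustache[OF m1] dist by auto
  obtain c b' where c: "{x4, c} \<in> E" "{x5, c} \<in> E" "c \<notin> {x1, x2, x3, x4, x5}"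
    and b': "b' \<notin> {x4, x5, c}" and inc_c: "inc c = {{x4, c}, {x5, c}, {c, b'}}"
    using moustache[OF m2] dist by auto
  note leaf_incs = leaf_inc[of x1 a] leaf_inc[of x2 a] leaf_inc[of x4 c] leaf_inc[of x5 c]
  have ab: "{a, b} \<in> E" using inc_a unfolding inc_def by blast
  have cb': "{c, b'} \<in> E" using inc_c unfolding inc_def by blast
  have "a \<noteq> c"
  proof
    assume "a = c"
    then have "{x4, a} \<in> inc a" "{x5, a} \<in> inc a"
      using c unfolding inc_def by simp_all
    then have "{x4, a} \<in> {{x1, a}, {x2, a}, {a, b}}" "{x5, a} \<in> {{x1, a}, {x2, a}, {a, b}}"
      unfolding inc_a .
    then show False
      using dist a by (auto simp: doubleton_eq_iff)
  qed
  have b_leaf: "b \<notin> {x1, x2, x4, x5}" and b'_leaf: "b' \<notin> {x1, x2, x4, x5}"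
    using leaf_nbr[of x4 c a] leaf_nbr[of x5 c a] leaf_nbr[of x1 a c] leaf_nbr[of x2 a c]
      ab cb' a c b b' \<open>a \<noteq> c\<close> by (auto simp: insert_commute)
  have "x3 \<in> V" "x4 \<in> V" "x1 \<in> V" "x2 \<in> V" "x5 \<in> V" "a \<in> V" "c \<in> V"
    using leaf ends a c by auto
  have closed: "S = V" if "u \<in> S" "S \<subseteq> V" "\<And>v e. v \<in> S \<Longrightarrow> e \<in> inc v \<Longrightarrow> e \<subseteq> S" for u S
  proof (rule graph_connected_closed_subset[OF conn that(1,2)])
    fix e assume "e \<in> E" "e \<inter> S \<noteq> {}"
    then obtain v where "v \<in> S" "e \<in> inc v" unfolding inc_def by blast
    then show "e \<subseteq> S" by (rule that(3))
  qed
  \<comment> \<open>Otherwise the edges at the first moustache alone would be a whole component.\<close>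
  have "b \<noteq> x3"
  proof
    assume "b = x3"
    then have "inc x3 = {{a, b}}"
      using leaf_inc[of x3 a] ab by (simp add: insert_commute)
    then have "{x1, x2, x3, a} = V"
      using \<open>b = x3\<close> leaf_incs a inc_a \<open>x1 \<in> V\<close> \<open>x2 \<in> V\<close> \<open>x3 \<in> V\<close> \<open>a \<in> V\<close>
      by (intro closed[of x1]) auto
    then show False
      using \<open>x4 \<in> V\<close> dist a by auto
  qed
  have "b' \<noteq> x3"
  proof
    assume "b' = x3"
    then have "inc x3 = {{c, b'}}"
      using leaf_inc[of x3 c] cb' by (simp add: insert_commute)
    then have "{x4, x5, x3, c} = V"
      using \<open>b' = x3\<close> leaf_incs c inc_c \<open>x4 \<in> V\<close> \<open>x5 \<in> V\<close> \<open>x3 \<in> V\<close> \<open>c \<in> V\<close>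
      by (intro closed[of x4]) auto
    then show False
      using \<open>x1 \<in> V\<close> dist c by auto
  qed
  have "b \<noteq> c"
  proof
    assume "b = c"
    then have "{a, c} \<in> inc c"
      using ab unfolding inc_def by blast
    then have "b' = a"
      using inc_c a \<open>a \<noteq> c\<close> by (auto simp: doubleton_eq_iff)
    then have "{x1, x2, x4, x5, a, c} = V"
      using \<open>b = c\<close> leaf_incs a c inc_a inc_c \<open>x1 \<in> V\<close> \<open>x2 \<in> V\<close> \<open>x4 \<in> V\<close> \<open>x5 \<in> V\<close> \<open>a \<in> V\<close> \<open>c \<in> V\<close>
      by (intro closed[of x1]) auto
    then show False
      using \<open>x3 \<in> V\<close> dist a c by auto
  qed
  have distinct: "distinct [x1, x2, x3, x4, x5, a, b, c]"
    using dist a b c b_leaf \<open>a \<noteq> c\<close> \<open>b \<noteq> x3\<close> \<open>b \<noteq> c\<close> by auto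
  have "b \<in> V" "b' \<in> V" using ends ab cb' by blast+
  \<comment> \<open>Five leaves leave room for only three inner vertices.\<close>
  have V: "V = {x1, x2, x3, x4, x5, a, b, c}"
  proof -
    have "card (tree_boundary V E) = 5"
      unfolding bdry using dist by simp
    then have "card (V - {x1, x2, x3, x4, x5}) \<le> card {a, b, c}"
      using binary_tree_card_inner_vertices[OF tree] bdry distinct by simp
    moreover have "{a, b, c} \<subseteq> V - {x1, x2, x3, x4, x5}"
      using \<open>a \<in> V\<close> \<open>b \<in> V\<close> \<open>c \<in> V\<close> distinct by auto
    ultimately have "{a, b, c} = V - {x1, x2, x3, x4, x5}"
      using fin by (intro card_seteq) auto
    moreover have "{x1, x2, x3, x4, x5} \<subseteq> V"
      using leaf by blast
    ultimately show ?thesis by blast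
  qed
  have "b' \<noteq> a"
  proof
    assume "b' = a"
    then have "{c, a} \<in> inc a" using cb' unfolding inc_def by blast
    then show False using inc_a distinct by (auto simp: doubleton_eq_iff)
  qed
  then have "b' = b"
    using \<open>b' \<in> V\<close> V b' b'_leaf \<open>b' \<noteq> x3\<close> by auto
  have x3: "{x3, b} \<in> E"
  proof -
    have "card (inc x3) = 1" using leaf by blast
    then obtain e where "e \<in> E" "x3 \<in> e"
      unfolding inc_def by (metis (mono_tags, lifting) card_1_singletonE insertI1 mem_Collect_eq)
    then obtain y where y: "y \<noteq> x3" "{x3, y} \<in> E"
      using edge doubleton_eq_card_2 by metis
    then have "{x3, y} \<in> inc y" "y \<in> V" using ends unfolding inc_def by auto
    moreover have "y \<notin> {x1, x2, x4, x5}"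
      using leaf_nbr[of x1 a x3] leaf_nbr[of x2 a x3] leaf_nbr[of x4 c x3] leaf_nbr[of x5 c x3]
        y a c distinct by (auto simp: insert_commute)
    moreover have "y \<noteq> a"
    proof
      assume "y = a"
      then have "{x3, a} \<in> {{x1, a}, {x2, a}, {a, b}}"
        using \<open>{x3, y} \<in> inc y\<close> unfolding inc_a[symmetric] by simp
      then show False using distinct by (auto simp: doubleton_eq_iff)
    qed
    moreover have "y \<noteq> c"
    proof
      assume "y = c"
      then have "{x3, c} \<in> {{x4, c}, {x5, c}, {c, b'}}"
        using \<open>{x3, y} \<in> inc y\<close> unfolding inc_c[symmetric] by simp
      then show False using distinct \<open>b' = b\<close> by (auto simp: doubleton_eq_iff)
    qed
    ultimately have "y = b"
      using V y by auto
    then show ?thesis using y by simp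
  qed
  have inc_b: "inc b = {{x3, b}, {a, b}, {b, c}}"
  proof (rule sym, rule card_seteq)
    have "card (inc b) = 3"
      using inner \<open>b \<in> V\<close> distinct by auto
    moreover have "card {{x3, b}, {a, b}, {b, c}} = 3"
      using distinct by (auto simp: doubleton_eq_iff)
    ultimately show "card (inc b) \<le> card {{x3, b}, {a, b}, {b, c}}" by simp
    show "finite (inc b)" using \<open>card (inc b) = 3\<close> by (simp add: card_ge_0_finite)
    show "{{x3, b}, {a, b}, {b, c}} \<subseteq> inc b"
      using x3 ab cb' \<open>b' = b\<close> unfolding inc_def by (auto simp: insert_commute)
  qed
  have "E = (\<Union>v\<in>V. inc v)"
  proof
    show "E \<subseteq> (\<Union>v\<in>V. inc v)"
    proof
      fix e assume "e \<in> E"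
      then have "e \<subseteq> V" "e \<noteq> {}" using edge by fastforce+
      then show "e \<in> (\<Union>v\<in>V. inc v)" using \<open>e \<in> E\<close> unfolding inc_def by blast
    qed
  qed (auto simp: inc_def)
  also have "\<dots> = {{x1, a}, {x2, a}, {x3, b}, {x4, c}, {x5, c}, {a, b}, {b, c}}"
    using leaf_inc[of x1 a] leaf_inc[of x2 a] leaf_inc[of x3 b] leaf_inc[of x4 c] leaf_inc[of x5 c]
      a c x3 inc_a inc_b inc_c \<open>b' = b\<close> unfolding V by (simp add: insert_commute)
  finally show thesis
    using that distinct V by blast
qed

text \<open>Here \<open>e1, \<dots>, e5\<close> are the edges at the leaves, and \<open>f\<close> and \<open>g\<close> are the two inner edges, on the sides
  of the first and of the second moustache.  The linear algebra that follows depends only on which of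
  the seven edges each path contains.\<close>

lemma binary_tree_two_moustaches_path_edges:
  assumes tree: "binary_tree V E"
    and dist: "distinct [x1, x2, x3, x4, x5]"
    and bdry: "tree_boundary V E = {x1, x2, x3, x4, x5}"
    and m1: "{x1, x2} \<in> moustaches V E" and m2: "{x4, x5} \<in> moustaches V E"
  obtains e1 e2 e3 e4 e5 f g where "distinct [e1, e2, e3, e4, e5, f, g]"
    and "E = {e1, e2, e3, e4, e5, f, g}"
    and "path_edges (tree_path V E x1 x2) = {e1, e2}"
    and "path_edges (tree_path V E x1 x3) = {e1, f, e3}"
    and "path_edges (tree_path V E x1 x4) = {e1, f, g, e4}"
    and "path_edges (tree_path V E x1 x5) = {e1, f, g, e5}"
    and "path_edges (tree_path V E x2 x3) = {e2, f, e3}"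
    and "path_edges (tree_path V E x2 x4) = {e2, f, g, e4}"
    and "path_edges (tree_path V E x2 x5) = {e2, f, g, e5}"
    and "path_edges (tree_path V E x3 x4) = {e3, g, e4}"
    and "path_edges (tree_path V E x3 x5) = {e3, g, e5}"
    and "path_edges (tree_path V E x4 x5) = {e4, e5}"
proof -
  obtain a b c where dist: "distinct [x1, x2, x3, x4, x5, a, b, c]"
    and V: "V = {x1, x2, x3, x4, x5, a, b, c}"
    and E: "E = {{x1, a}, {x2, a}, {x3, b}, {x4, c}, {x5, c}, {a, b}, {b, c}}"
    using binary_tree_two_moustaches[OF assms] by blast
  have tree: "is_tree V E"
    using tree by (simp add: binary_tree_def)
  have path: "path_edges (tree_path V E u v) = path_edges xs" if "graph_path V E u xs v" for u xs v
    using tree_path_eqI[OF tree that] by simp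
  have dist': "distinct [c, b, a, x5, x4, x3, x2, x1]"
    using dist by auto
  have edges: "{x1, a} \<in> E" "{a, x2} \<in> E" "{x2, a} \<in> E" "{x3, b} \<in> E" "{b, x3} \<in> E" "{c, x4} \<in> E"
    "{x4, c} \<in> E" "{c, x5} \<in> E" "{a, b} \<in> E" "{b, c} \<in> E"
    unfolding E by (simp_all add: insert_commute)
  \<comment> \<open>Paths traverse these edges against the direction in which \<open>E\<close> lists them.\<close>
  have comm: "{a, x2} = {x2, a}" "{b, x3} = {x3, b}" "{c, x4} = {x4, c}" "{c, x5} = {x5, c}"
    by auto
  show thesis
  proof
    show "distinct [{x1, a}, {x2, a}, {x3, b}, {x4, c}, {x5, c}, {a, b}, {b, c}]"
      using dist by (auto simp: doubleton_eq_iff)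
    show "E = {{x1, a}, {x2, a}, {x3, b}, {x4, c}, {x5, c}, {a, b}, {b, c}}"
      by (fact E)
    show "path_edges (tree_path V E x1 x2) = {{x1, a}, {x2, a}}"
      using path[of x1 "[x1, a, x2]"] dist dist' edges V by (simp add: comm)
    show "path_edges (tree_path V E x1 x3) = {{x1, a}, {a, b}, {x3, b}}"
      using path[of x1 "[x1, a, b, x3]"] dist dist' edges V by (simp add: comm)
    show "path_edges (tree_path V E x1 x4) = {{x1, a}, {a, b}, {b, c}, {x4, c}}"
      using path[of x1 "[x1, a, b, c, x4]"] dist dist' edges V by (simp add: comm)
    show "path_edges (tree_path V E x1 x5) = {{x1, a}, {a, b}, {b, c}, {x5, c}}"
      using path[of x1 "[x1, a, b, c, x5]"] dist dist' edges V by (simp add: comm)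
    show "path_edges (tree_path V E x2 x3) = {{x2, a}, {a, b}, {x3, b}}"
      using path[of x2 "[x2, a, b, x3]"] dist dist' edges V by (simp add: comm)
    show "path_edges (tree_path V E x2 x4) = {{x2, a}, {a, b}, {b, c}, {x4, c}}"
      using path[of x2 "[x2, a, b, c, x4]"] dist dist' edges V by (simp add: comm)
    show "path_edges (tree_path V E x2 x5) = {{x2, a}, {a, b}, {b, c}, {x5, c}}"
      using path[of x2 "[x2, a, b, c, x5]"] dist dist' edges V by (simp add: comm)
    show "path_edges (tree_path V E x3 x4) = {{x3, b}, {b, c}, {x4, c}}"
      using path[of x3 "[x3, b, c, x4]"] dist dist' edges V by (simp add: comm)
    show "path_edges (tree_path V E x3 x5) = {{x3, b}, {b, c}, {x5, c}}"
      using path[of x3 "[x3, b, c, x5]"] dist dist' edges V by (simp add: comm)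
    show "path_edges (tree_path V E x4 x5) = {{x4, c}, {x5, c}}"
      using path[of x4 "[x4, c, x5]"] dist dist' edges V by (simp add: comm)
  qed
qed

section \<open>The tetrahedron in ten-dimensional space\<close>

lemma exhaust_10:
  fixes x :: 10
  shows "x = 1 \<or> x = 2 \<or> x = 3 \<or> x = 4 \<or> x = 5 \<or> x = 6 \<or> x = 7 \<or> x = 8 \<or> x = 9 \<or> x = 10"
proof (induct x)
  case (of_int z)
  then have "0 \<le> z" and "z < 10" by simp_all
  then have "z = 0 \<or> z = 1 \<or> z = 2 \<or> z = 3 \<or> z = 4 \<or> z = 5 \<or> z = 6 \<or> z = 7 \<or> z = 8 \<or> z = 9"
    by arith
  then show ?case by auto
qed

lemma forall_10:
  "(\<forall>i::10. P i) \<longleftrightarrow> P 1 \<and> P 2 \<and> P 3 \<and> P 4 \<and> P 5 \<and> P 6 \<and> P 7 \<and> P 8 \<and> P 9 \<and> P 10"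
  by (metis exhaust_10)

lemma vector_10 [simp]:
  "(vector [x1, x2, x3, x4, x5, x6, x7, x8, x9, x10] :: 'a::zero^10) $ 1 = x1"
  "(vector [x1, x2, x3, x4, x5, x6, x7, x8, x9, x10] :: 'a::zero^10) $ 2 = x2"
  "(vector [x1, x2, x3, x4, x5, x6, x7, x8, x9, x10] :: 'a::zero^10) $ 3 = x3"
  "(vector [x1, x2, x3, x4, x5, x6, x7, x8, x9, x10] :: 'a::zero^10) $ 4 = x4"
  "(vector [x1, x2, x3, x4, x5, x6, x7, x8, x9, x10] :: 'a::zero^10) $ 5 = x5"
  "(vector [x1, x2, x3, x4, x5, x6, x7, x8, x9, x10] :: 'a::zero^10) $ 6 = x6"
  "(vector [x1, x2, x3, x4, x5, x6, x7, x8, x9, x10] :: 'a::zero^10) $ 7 = x7"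
  "(vector [x1, x2, x3, x4, x5, x6, x7, x8, x9, x10] :: 'a::zero^10) $ 8 = x8"
  "(vector [x1, x2, x3, x4, x5, x6, x7, x8, x9, x10] :: 'a::zero^10) $ 9 = x9"
  "(vector [x1, x2, x3, x4, x5, x6, x7, x8, x9, x10] :: 'a::zero^10) $ 10 = x10"
  unfolding vector_def by simp_all

definition Lambda5_vertices :: "(real ^ 10) set" where
  "Lambda5_vertices =
     {(1/2) *\<^sub>R vector [1,0,0,1,1,0,0,1,0,1],
      (1/2) *\<^sub>R vector [1,1,0,0,0,0,1,1,0,1],
      (1/2) *\<^sub>R vector [1,0,1,0,1,0,0,0,1,1],
      (1/2) *\<^sub>R vector [1,1,0,0,0,1,0,0,1,1]}"

lemma sum_Lambda5_vertices:
  fixes f :: "real ^ 10 \<Rightarrow> 'b::ab_group_add"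
  shows "sum f Lambda5_vertices =
    f ((1/2) *\<^sub>R vector [1,0,0,1,1,0,0,1,0,1]) + f ((1/2) *\<^sub>R vector [1,1,0,0,0,0,1,1,0,1]) +
    f ((1/2) *\<^sub>R vector [1,0,1,0,1,0,0,0,1,1]) + f ((1/2) *\<^sub>R vector [1,1,0,0,0,1,0,0,1,1])"
  unfolding Lambda5_vertices_def by (simp add: vec_eq_iff forall_10 add.assoc)

lemma card_Lambda5_vertices: "card Lambda5_vertices = 4"
  unfolding Lambda5_vertices_def by (simp add: vec_eq_iff forall_10)

lemma finite_Lambda5_vertices: "finite Lambda5_vertices"
  unfolding Lambda5_vertices_def by simp

text \<open>Among the coordinates 3, 4, 6 and 7 each vertex has exactly one that is nonzero, and different
  vertices have different ones.\<close>

lemma affine_independent_Lambda5_vertices: "\<not> affine_dependent Lambda5_vertices"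
proof
  assume "affine_dependent Lambda5_vertices"
  then obtain U where ne: "\<exists>v\<in>Lambda5_vertices. U v \<noteq> 0"
    and zero: "(\<Sum>v\<in>Lambda5_vertices. U v *\<^sub>R v) = 0"
    using affine_dependent_explicit_finite[OF finite_Lambda5_vertices] by blast
  have "\<forall>v\<in>Lambda5_vertices. U v = 0"
    using zero unfolding sum_Lambda5_vertices
    by (simp add: vec_eq_iff forall_10 Lambda5_vertices_def)
  with ne show False by blast
qed

text \<open>The parameters \<open>p, q, r, s\<close> are the coordinates \<open>\<lambda>\<^sub>1\<^sub>4, \<lambda>\<^sub>1\<^sub>5, \<lambda>\<^sub>2\<^sub>4, \<lambda>\<^sub>2\<^sub>5\<close>.\<close>

lemma convex_hull_Lambda5_vertices:
  "convex hull Lambda5_vertices =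
     {vector [1/2, r + s, p, q, p + q, r, s, q + s, p + r, 1/2] | p q r s.
        0 \<le> p \<and> 0 \<le> q \<and> 0 \<le> r \<and> 0 \<le> s \<and> p + q + r + s = 1/2}" (is "?L = ?R")
proof
  show "?L \<subseteq> ?R"
  proof
    fix y assume "y \<in> ?L"
    then obtain u where u: "\<forall>x\<in>Lambda5_vertices. 0 \<le> u x" "sum u Lambda5_vertices = 1"
      "(\<Sum>x\<in>Lambda5_vertices. u x *\<^sub>R x) = y"
      unfolding convex_hull_finite[OF finite_Lambda5_vertices] by blast
    let ?p = "u ((1/2) *\<^sub>R vector [1,0,1,0,1,0,0,0,1,1]) / 2"
    let ?q = "u ((1/2) *\<^sub>R vector [1,0,0,1,1,0,0,1,0,1]) / 2"
    let ?r = "u ((1/2) *\<^sub>R vector [1,1,0,0,0,1,0,0,1,1]) / 2"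
    let ?s = "u ((1/2) *\<^sub>R vector [1,1,0,0,0,0,1,1,0,1]) / 2"
    have "0 \<le> ?p \<and> 0 \<le> ?q \<and> 0 \<le> ?r \<and> 0 \<le> ?s"
      using u(1) by (simp add: Lambda5_vertices_def)
    moreover have "?p + ?q + ?r + ?s = 1/2"
      using u(2) unfolding sum_Lambda5_vertices by simp
    moreover from this
    have "y = vector [1/2, ?r + ?s, ?p, ?q, ?p + ?q, ?r, ?s, ?q + ?s, ?p + ?r, 1/2]"
      using u(3) unfolding sum_Lambda5_vertices by (auto simp: vec_eq_iff forall_10)
    ultimately show "y \<in> ?R" by blast
  qed
next
  show "?R \<subseteq> ?L"
  proof
    fix y assume "y \<in> ?R"
    then obtain p q r s :: real where pqrs: "0 \<le> p" "0 \<le> q" "0 \<le> r" "0 \<le> s" "p + q + r + s = 1/2"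
      and y: "y = vector [1/2, r + s, p, q, p + q, r, s, q + s, p + r, 1/2]" by blast
    \<comment> \<open>Exactly one of the coordinates 3, 4, 6, 7 of a vertex is nonzero, and it is \<open>1/2\<close>; so
      this is the barycentric coordinate of \<open>y\<close> at \<open>x\<close>.\<close>
    define u where "u x = 4 * (p * x $ 3 + q * x $ 4 + r * x $ 6 + s * x $ 7)" for x :: "real ^ 10"
    have "\<forall>x\<in>Lambda5_vertices. 0 \<le> u x"
      using pqrs by (simp add: Lambda5_vertices_def u_def)
    moreover have "sum u Lambda5_vertices = 1"
      using pqrs unfolding sum_Lambda5_vertices by (simp add: u_def)
    moreover have "(\<Sum>x\<in>Lambda5_vertices. u x *\<^sub>R x) = y"
      using pqrs unfolding sum_Lambda5_vertices y by (simp add: vec_eq_iff forall_10 u_def)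
    ultimately show "y \<in> ?L"
      unfolding convex_hull_finite[OF finite_Lambda5_vertices] by blast
  qed
qed

section \<open>The linear program and its dual\<close>

lemma index_pairs_eq_set_lex_pairs: "index_pairs n = set (lex_pairs n)"
  by (auto simp: index_pairs_def lex_pairs_def image_iff)

lemma sum_index_pairs_filter:
  "(\<Sum>(i, j) | (i, j) \<in> index_pairs n \<and> P i j. l i j) =
   (\<Sum>(i, j)\<in>index_pairs n. if P i j then l i j else 0)"
proof -
  have "{(i, j). (i, j) \<in> index_pairs n \<and> P i j} = {x \<in> index_pairs n. case x of (i, j) \<Rightarrow> P i j}"
    by auto
  then have "(\<Sum>(i, j) | (i, j) \<in> index_pairs n \<and> P i j. l i j) =
      (\<Sum>x\<in>index_pairs n. if case x of (i, j) \<Rightarrow> P i j then case x of (i, j) \<Rightarrow> l i j else 0)"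
    by (simp only:) (rule sum.inter_filter, simp add: index_pairs_eq_set_lex_pairs)
  also have "\<dots> = (\<Sum>(i, j)\<in>index_pairs n. if P i j then l i j else 0)"
    by (intro sum.cong) auto
  finally show ?thesis .
qed

context
  fixes V :: "'v set" and E :: "'v set set" and p :: "nat \<Rightarrow> 'v"
    and e1 e2 e3 e4 e5 f g :: "'v set"
  assumes tree: "is_tree V E" and leaf: "\<forall>i\<in>{1..5}. p i \<in> tree_boundary V E"
    and edges_distinct: "distinct [e1, e2, e3, e4, e5, f, g]"
    and E: "E = {e1, e2, e3, e4, e5, f, g}"
    and paths: "path_edges (tree_path V E (p 1) (p 2)) = {e1, e2}"
      "path_edges (tree_path V E (p 1) (p 3)) = {e1, f, e3}"
      "path_edges (tree_path V E (p 1) (p 4)) = {e1, f, g, e4}"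
      "path_edges (tree_path V E (p 1) (p 5)) = {e1, f, g, e5}"
      "path_edges (tree_path V E (p 2) (p 3)) = {e2, f, e3}"
      "path_edges (tree_path V E (p 2) (p 4)) = {e2, f, g, e4}"
      "path_edges (tree_path V E (p 2) (p 5)) = {e2, f, g, e5}"
      "path_edges (tree_path V E (p 3) (p 4)) = {e3, g, e4}"
      "path_edges (tree_path V E (p 3) (p 5)) = {e3, g, e5}"
      "path_edges (tree_path V E (p 4) (p 5)) = {e4, e5}"
begin

lemma edges_neq: "distinct [e1, e2, e3, e4, e5, f, g]" "distinct [g, f, e5, e4, e3, e2, e1]"
  using edges_distinct distinct_rev[of "[e1, e2, e3, e4, e5, f, g]"]
  by (simp_all only: rev.simps append.simps)

text \<open>One equation for each of the edges \<open>e1, e2, e3, e4, e5, f, g\<close>, in this order.\<close>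

lemma Lambda5_constraints:
  "(\<forall>e\<in>E. (\<Sum>(i, j) | (i, j) \<in> index_pairs 5 \<and> separated_by V E e (p i) (p j). l (i, j)) = (1::real))
   \<longleftrightarrow> l (1,2) + l (1,3) + l (1,4) + l (1,5) = 1 \<and>
       l (1,2) + l (2,3) + l (2,4) + l (2,5) = 1 \<and>
       l (1,3) + l (2,3) + l (3,4) + l (3,5) = 1 \<and>
       l (1,4) + l (2,4) + l (3,4) + l (4,5) = 1 \<and>
       l (1,5) + l (2,5) + l (3,5) + l (4,5) = 1 \<and>
       l (1,3) + l (1,4) + l (1,5) + l (2,3) + l (2,4) + l (2,5) = 1 \<and>
       l (1,4) + l (1,5) + l (2,4) + l (2,5) + l (3,4) + l (3,5) = 1"
proof -
  have sep: "separated_by V E e (p i) (p j) \<longleftrightarrow> e \<in> path_edges (tree_path V E (p i) (p j))"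
    if "i \<in> {1..5}" "j \<in> {1..5}" for e i j
    using separated_by_iff_mem_path_edges[OF tree] leaf that by blast
  have crossing: "(\<Sum>(i, j) | (i, j) \<in> index_pairs 5 \<and> separated_by V E e (p i) (p j). l (i, j)) =
      (if e \<in> {e1, e2} then l (1,2) else 0) + (if e \<in> {e1, f, e3} then l (1,3) else 0) +
      (if e \<in> {e1, f, g, e4} then l (1,4) else 0) + (if e \<in> {e1, f, g, e5} then l (1,5) else 0) +
      (if e \<in> {e2, f, e3} then l (2,3) else 0) + (if e \<in> {e2, f, g, e4} then l (2,4) else 0) +
      (if e \<in> {e2, f, g, e5} then l (2,5) else 0) + (if e \<in> {e3, g, e4} then l (3,4) else 0) +
      (if e \<in> {e3, g, e5} then l (3,5) else 0) + (if e \<in> {e4, e5} then l (4,5) else 0)" for e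
  proof -
    have "(\<Sum>(i, j) | (i, j) \<in> index_pairs 5 \<and> separated_by V E e (p i) (p j). l (i, j)) =
        (\<Sum>(i, j)\<in>set (lex_pairs 5). if separated_by V E e (p i) (p j) then l (i, j) else 0)"
      unfolding sum_index_pairs_filter index_pairs_eq_set_lex_pairs[symmetric] ..
    also have "\<dots> = (\<Sum>(i, j)\<in>set (lex_pairs 5).
        if e \<in> path_edges (tree_path V E (p i) (p j)) then l (i, j) else 0)"
      by (intro sum.cong) (auto simp: sep lex_pairs_5 simp del: One_nat_def)
    also have "\<dots> = (\<Sum>(i, j)\<leftarrow>lex_pairs 5.
        if e \<in> path_edges (tree_path V E (p i) (p j)) then l (i, j) else 0)"
      by (rule sum.distinct_set_conv_list) (simp add: lex_pairs_5)
    finally show ?thesis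
      by (simp only: lex_pairs_5 list.map sum_list.Cons sum_list.Nil case_prod_conv paths
          add.assoc add_0_right)
  qed
  have all_edges: "(\<forall>e\<in>E. P e) \<longleftrightarrow> P e1 \<and> P e2 \<and> P e3 \<and> P e4 \<and> P e5 \<and> P f \<and> P g" for P
    unfolding E by simp
  show ?thesis
    unfolding crossing all_edges using edges_neq by (simp del: One_nat_def)
qed

text \<open>Adding the equations of \<open>e1\<close> and \<open>e2\<close> and subtracting that of \<open>f\<close> leaves \<open>2 \<lambda>\<^sub>1\<^sub>2 = 1\<close>; likewise
  \<open>2 \<lambda>\<^sub>4\<^sub>5 = 1\<close>.  Then the equations of \<open>f\<close>, \<open>g\<close> and \<open>e3\<close> give
  \<open>\<lambda>\<^sub>1\<^sub>4 + \<lambda>\<^sub>1\<^sub>5 + \<lambda>\<^sub>2\<^sub>4 + \<lambda>\<^sub>2\<^sub>5 = 1/2\<close>, and those of the edges at the leaves determine the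
  remaining coordinates.\<close>

lemma Lambda5_eq_convex_hull: "Lambda5 p V E = convex hull Lambda5_vertices" (is "?L = ?R")
proof
  show "?L \<subseteq> ?R"
  proof
    fix v assume "v \<in> ?L"
    then obtain l where v: "v = vector (map l (lex_pairs 5))"
      and nonneg: "\<forall>(i, j)\<in>index_pairs 5. 0 \<le> l (i, j)"
      and "\<forall>e\<in>E. (\<Sum>(i, j) | (i, j) \<in> index_pairs 5 \<and> separated_by V E e (p i) (p j). l (i, j)) = 1"
      unfolding Lambda5_def by (elim CollectE exE conjE) (rule that)
    then have c: "l (1,2) + l (1,3) + l (1,4) + l (1,5) = 1"
        "l (1,2) + l (2,3) + l (2,4) + l (2,5) = 1"
        "l (1,3) + l (2,3) + l (3,4) + l (3,5) = 1"
        "l (1,4) + l (2,4) + l (3,4) + l (4,5) = 1"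
        "l (1,5) + l (2,5) + l (3,5) + l (4,5) = 1"
        "l (1,3) + l (1,4) + l (1,5) + l (2,3) + l (2,4) + l (2,5) = 1"
        "l (1,4) + l (1,5) + l (2,4) + l (2,5) + l (3,4) + l (3,5) = 1"
      unfolding Lambda5_constraints by blast+
    have eqs: "l (1,2) = 1/2" "l (1,3) = l (2,4) + l (2,5)" "l (2,3) = l (1,4) + l (1,5)"
      "l (3,4) = l (1,5) + l (2,5)" "l (3,5) = l (1,4) + l (2,4)" "l (4,5) = 1/2"
      using c by linarith+
    have "v = vector [1/2, l (2,4) + l (2,5), l (1,4), l (1,5), l (1,4) + l (1,5),
        l (2,4), l (2,5), l (1,5) + l (2,5), l (1,4) + l (2,4), 1/2]"
      unfolding v lex_pairs_5 list.map eqs ..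
    moreover have "0 \<le> l (1,4) \<and> 0 \<le> l (1,5) \<and> 0 \<le> l (2,4) \<and> 0 \<le> l (2,5)"
      using nonneg by (simp add: index_pairs_eq_set_lex_pairs lex_pairs_5)
    moreover have "l (1,4) + l (1,5) + l (2,4) + l (2,5) = 1/2"
      using c by linarith
    ultimately show "v \<in> ?R"
      unfolding convex_hull_Lambda5_vertices mem_Collect_eq by (metis (no_types, lifting))
  qed
next
  show "?R \<subseteq> ?L"
  proof
    fix v assume "v \<in> ?R"
    then obtain q14 q15 q24 q25 :: real
      where q: "0 \<le> q14" "0 \<le> q15" "0 \<le> q24" "0 \<le> q25" "q14 + q15 + q24 + q25 = 1/2"
      and v: "v = vector [1/2, q24 + q25, q14, q15, q14 + q15, q24, q25, q15 + q25, q14 + q24, 1/2]"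
      unfolding convex_hull_Lambda5_vertices by (elim CollectE exE conjE) (rule that)
    define l :: "nat \<times> nat \<Rightarrow> real" where
      "l = (\<lambda>_. 0)((1,2) := 1/2, (1,3) := q24 + q25, (1,4) := q14, (1,5) := q15,
        (2,3) := q14 + q15, (2,4) := q24, (2,5) := q25, (3,4) := q15 + q25, (3,5) := q14 + q24,
        (4,5) := 1/2)"
    have "v = vector (map l (lex_pairs 5))"
      unfolding v lex_pairs_5 by (simp add: l_def)
    moreover have "\<forall>(i, j)\<in>index_pairs 5. 0 \<le> l (i, j)"
      using q by (simp add: index_pairs_eq_set_lex_pairs lex_pairs_5 l_def)
    moreover have
      "\<forall>e\<in>E. (\<Sum>(i, j) | (i, j) \<in> index_pairs 5 \<and> separated_by V E e (p i) (p j). l (i, j)) = 1"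
      unfolding Lambda5_constraints using q by (simp add: l_def)
    ultimately show "v \<in> ?L"
      unfolding Lambda5_def by (intro CollectI exI[of _ l] conjI)
  qed
qed

lemma generalized_filling_iff:
  "generalized_filling 5 p \<rho> V E \<omega> \<longleftrightarrow>
     \<rho> (p 1) (p 2) \<le> \<omega> e1 + \<omega> e2 \<and>
     \<rho> (p 1) (p 3) \<le> \<omega> e1 + \<omega> f + \<omega> e3 \<and>
     \<rho> (p 1) (p 4) \<le> \<omega> e1 + \<omega> f + \<omega> g + \<omega> e4 \<and>
     \<rho> (p 1) (p 5) \<le> \<omega> e1 + \<omega> f + \<omega> g + \<omega> e5 \<and>
     \<rho> (p 2) (p 3) \<le> \<omega> e2 + \<omega> f + \<omega> e3 \<and>
     \<rho> (p 2) (p 4) \<le> \<omega> e2 + \<omega> f + \<omega> g + \<omega> e4 \<and>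
     \<rho> (p 2) (p 5) \<le> \<omega> e2 + \<omega> f + \<omega> g + \<omega> e5 \<and>
     \<rho> (p 3) (p 4) \<le> \<omega> e3 + \<omega> g + \<omega> e4 \<and>
     \<rho> (p 3) (p 5) \<le> \<omega> e3 + \<omega> g + \<omega> e5 \<and>
     \<rho> (p 4) (p 5) \<le> \<omega> e4 + \<omega> e5"
  unfolding generalized_filling_def index_pairs_eq_set_lex_pairs lex_pairs_5
  using edges_neq by (simp add: paths add.assoc del: One_nat_def)

text \<open>For the lower bound, the five inequalities belonging to a vertex of the tetrahedron add up to twice
  the weight, since together their paths use every edge exactly twice.  For the upper bound, the
  inequalities for the pairs 12, 13, 23, 34, 35, 45 are solved as equations, which leaves \<open>\<omega> e3\<close> free; it
  is chosen so that the total weight is the maximum \<open>T\<close>.  Then the inequalities for the four pairs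
  across the tree, 14, 15, 24 and 25, say precisely that \<open>T\<close> is at least each of the four values.\<close>

lemma mpf_minus_eq_Max:
  fixes \<rho> :: "'v \<Rightarrow> 'v \<Rightarrow> real"
  defines "d \<equiv> \<lambda>i j. \<rho> (p i) (p j)"
  shows "mpf_minus 5 p \<rho> V E = ereal (Max
       {1/2 * (d 1 2 + d 1 5 + d 2 3 + d 3 4 + d 4 5),
        1/2 * (d 1 2 + d 1 3 + d 2 5 + d 3 4 + d 4 5),
        1/2 * (d 1 2 + d 1 4 + d 2 3 + d 3 5 + d 4 5),
        1/2 * (d 1 2 + d 1 3 + d 2 4 + d 3 5 + d 4 5)})" (is "_ = ereal (Max ?D)")
proof -
  define T where "T = Max ?D"
  have T_ge: "d 1 2 + d 1 5 + d 2 3 + d 3 4 + d 4 5 \<le> 2 * T"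
    "d 1 2 + d 1 3 + d 2 5 + d 3 4 + d 4 5 \<le> 2 * T"
    "d 1 2 + d 1 4 + d 2 3 + d 3 5 + d 4 5 \<le> 2 * T"
    "d 1 2 + d 1 3 + d 2 4 + d 3 5 + d 4 5 \<le> 2 * T"
  proof -
    have le: "x \<le> T" if "x \<in> ?D" for x
      unfolding T_def by (rule Max_ge[OF _ that]) (simp only: finite_insert finite.emptyI)
    have "1/2 * (d 1 2 + d 1 5 + d 2 3 + d 3 4 + d 4 5) \<le> T"
      "1/2 * (d 1 2 + d 1 3 + d 2 5 + d 3 4 + d 4 5) \<le> T"
      "1/2 * (d 1 2 + d 1 4 + d 2 3 + d 3 5 + d 4 5) \<le> T"
      "1/2 * (d 1 2 + d 1 3 + d 2 4 + d 3 5 + d 4 5) \<le> T"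
      by (rule le, simp only: insert_iff simp_thms)+
    then show "d 1 2 + d 1 5 + d 2 3 + d 3 4 + d 4 5 \<le> 2 * T"
      "d 1 2 + d 1 3 + d 2 5 + d 3 4 + d 4 5 \<le> 2 * T"
      "d 1 2 + d 1 4 + d 2 3 + d 3 5 + d 4 5 \<le> 2 * T"
      "d 1 2 + d 1 3 + d 2 4 + d 3 5 + d 4 5 \<le> 2 * T"
      by simp_all
  qed
  have weight: "(\<Sum>e\<in>E. \<omega> e) = \<omega> e1 + \<omega> e2 + \<omega> e3 + \<omega> e4 + \<omega> e5 + \<omega> f + \<omega> g" for \<omega> :: "'v set \<Rightarrow> real"
    unfolding E using edges_neq by (simp add: add.assoc)
  show ?thesis
    unfolding mpf_minus_def T_def[symmetric]
  proof (rule antisym)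
    define t3 where "t3 = (d 1 2 + d 4 5 + d 1 3 + d 2 3 + d 3 4 + d 3 5) / 2 - T"
    define \<omega> :: "'v set \<Rightarrow> real" where
      "\<omega> = (\<lambda>_. 0)(
        e1 := (d 1 2 + d 1 3 - d 2 3) / 2, e2 := (d 1 2 - d 1 3 + d 2 3) / 2,
        e3 := t3,
        e4 := (d 4 5 + d 3 4 - d 3 5) / 2, e5 := (d 4 5 - d 3 4 + d 3 5) / 2,
        f := (d 1 3 + d 2 3 - d 1 2) / 2 - t3, g := (d 3 4 + d 3 5 - d 4 5) / 2 - t3)"
    have \<omega>: "2 * \<omega> e1 = d 1 2 + d 1 3 - d 2 3" "2 * \<omega> e2 = d 1 2 - d 1 3 + d 2 3"
      "\<omega> e3 = t3"
      "2 * \<omega> e4 = d 4 5 + d 3 4 - d 3 5" "2 * \<omega> e5 = d 4 5 - d 3 4 + d 3 5"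
      "2 * \<omega> f = d 1 3 + d 2 3 - d 1 2 - 2 * t3" "2 * \<omega> g = d 3 4 + d 3 5 - d 4 5 - 2 * t3"
      using edges_neq unfolding \<omega>_def by (simp_all del: One_nat_def)
    have t3: "2 * t3 = d 1 2 + d 4 5 + d 1 3 + d 2 3 + d 3 4 + d 3 5 - 2 * T"
      unfolding t3_def by simp
    have "generalized_filling 5 p \<rho> V E \<omega>"
      unfolding generalized_filling_iff
      using T_ge \<omega> t3 unfolding d_def by (intro conjI; linarith)
    moreover have "(\<Sum>e\<in>E. \<omega> e) = T"
      unfolding weight using \<omega> t3 by linarith
    ultimately show "(INF \<omega>\<in>{\<omega>. generalized_filling 5 p \<rho> V E \<omega>}. ereal (\<Sum>e\<in>E. \<omega> e)) \<le> ereal T"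
      by (intro INF_lower2[of \<omega>]) auto
  next
    show "ereal T \<le> (INF \<omega>\<in>{\<omega>. generalized_filling 5 p \<rho> V E \<omega>}. ereal (\<Sum>e\<in>E. \<omega> e))"
    proof (rule INF_greatest)
      fix \<omega> assume "\<omega> \<in> {\<omega>. generalized_filling 5 p \<rho> V E \<omega>}"
      then have fill: "d 1 2 \<le> \<omega> e1 + \<omega> e2"
        "d 1 3 \<le> \<omega> e1 + \<omega> f + \<omega> e3"
        "d 1 4 \<le> \<omega> e1 + \<omega> f + \<omega> g + \<omega> e4"
        "d 1 5 \<le> \<omega> e1 + \<omega> f + \<omega> g + \<omega> e5"
        "d 2 3 \<le> \<omega> e2 + \<omega> f + \<omega> e3"
        "d 2 4 \<le> \<omega> e2 + \<omega> f + \<omega> g + \<omega> e4"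
        "d 2 5 \<le> \<omega> e2 + \<omega> f + \<omega> g + \<omega> e5"
        "d 3 4 \<le> \<omega> e3 + \<omega> g + \<omega> e4"
        "d 3 5 \<le> \<omega> e3 + \<omega> g + \<omega> e5"
        "d 4 5 \<le> \<omega> e4 + \<omega> e5"
        unfolding generalized_filling_iff d_def by simp_all
      have half: "T = 1/2 * x \<longleftrightarrow> 2 * T = x" for x
        by auto
      have "T \<in> ?D"
        unfolding T_def by (rule Max_in)
          (simp_all only: finite_insert finite.emptyI insert_not_empty not_False_eq_True)
      then have "2 * T \<le> 2 * (\<Sum>e\<in>E. \<omega> e)"
        unfolding insert_iff empty_iff half weight distrib_left
        by (elim disjE FalseE) (use fill in linarith)+
      then show "ereal T \<le> ereal (\<Sum>e\<in>E. \<omega> e)"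
        by simp
    qed
  qed
qed

end

theorem mainTheorem3:
  fixes V M :: "'v set" and E :: "'v set set" and p :: "nat \<Rightarrow> 'v"
    and \<rho> :: "'v \<Rightarrow> 'v \<Rightarrow> real" and d :: "nat \<Rightarrow> nat \<Rightarrow> real"
  assumes "Metric_space M \<rho>"
    and "bij_betw p {1..5} M"
    and "\<And>i j. d i j = \<rho> (p i) (p j)"
    and "binary_tree V E"
    and "tree_boundary V E = M"
    and "moustaches V E = {{p 1, p 2}, {p 4, p 5}}"
  shows "3 simplex (Lambda5 p V E) \<and>
     {v. v extreme_point_of (Lambda5 p V E)} =
       {(1/2) *\<^sub>R vector [1,0,0,1,1,0,0,1,0,1],
        (1/2) *\<^sub>R vector [1,1,0,0,0,0,1,1,0,1],
        (1/2) *\<^sub>R vector [1,0,1,0,1,0,0,0,1,1],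
        (1/2) *\<^sub>R vector [1,1,0,0,0,1,0,0,1,1]} \<and>
     mpf_minus 5 p \<rho> V E = ereal (Max
       {1/2 * (d 1 2 + d 1 5 + d 2 3 + d 3 4 + d 4 5),
        1/2 * (d 1 2 + d 1 3 + d 2 5 + d 3 4 + d 4 5),
        1/2 * (d 1 2 + d 1 4 + d 2 3 + d 3 5 + d 4 5),
        1/2 * (d 1 2 + d 1 3 + d 2 4 + d 3 5 + d 4 5)})"
proof -
  have "{1..5::nat} = {1, 2, 3, 4, 5}" by auto
  then have M: "M = {p 1, p 2, p 3, p 4, p 5}" and inj: "inj_on p {1, 2, 3, 4, 5}"
    using assms(2) by (auto simp: bij_betw_def)
  have dist: "distinct [p 1, p 2, p 3, p 4, p 5]"
    using inj by (simp add: inj_on_def)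
  have bdry: "tree_boundary V E = {p 1, p 2, p 3, p 4, p 5}"
    using assms(5) M by simp
  have moust: "{p 1, p 2} \<in> moustaches V E" "{p 4, p 5} \<in> moustaches V E"
    using assms(6) by simp_all
  have tree: "is_tree V E" using assms(4) by (simp add: binary_tree_def)
  have leaf: "\<forall>i\<in>{1..5}. p i \<in> tree_boundary V E"
    using assms(2,5) by (auto simp: bij_betw_def)
  obtain e1 e2 e3 e4 e5 f g where shape: "distinct [e1, e2, e3, e4, e5, f, g]"
    "E = {e1, e2, e3, e4, e5, f, g}"
    "path_edges (tree_path V E (p 1) (p 2)) = {e1, e2}"
    "path_edges (tree_path V E (p 1) (p 3)) = {e1, f, e3}"
    "path_edges (tree_path V E (p 1) (p 4)) = {e1, f, g, e4}"
    "path_edges (tree_path V E (p 1) (p 5)) = {e1, f, g, e5}"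
    "path_edges (tree_path V E (p 2) (p 3)) = {e2, f, e3}"
    "path_edges (tree_path V E (p 2) (p 4)) = {e2, f, g, e4}"
    "path_edges (tree_path V E (p 2) (p 5)) = {e2, f, g, e5}"
    "path_edges (tree_path V E (p 3) (p 4)) = {e3, g, e4}"
    "path_edges (tree_path V E (p 3) (p 5)) = {e3, g, e5}"
    "path_edges (tree_path V E (p 4) (p 5)) = {e4, e5}"
    by (rule binary_tree_two_moustaches_path_edges[OF assms(4) dist bdry moust])
  note Lambda = Lambda5_eq_convex_hull[OF tree leaf shape]
  have "3 simplex (Lambda5 p V E)"
    unfolding simplex_def Lambda
    using affine_independent_Lambda5_vertices card_Lambda5_vertices by (intro exI[of _ Lambda5_vertices]) simp
  moreover have "{v. v extreme_point_of (Lambda5 p V E)} = Lambda5_vertices"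
    unfolding Lambda
    using extreme_point_of_convex_hull_affine_independent[OF affine_independent_Lambda5_vertices]
    by blast
  moreover have "d = (\<lambda>i j. \<rho> (p i) (p j))"
    using assms(3) by blast
  ultimately show ?thesis
    using mpf_minus_eq_Max[OF tree leaf shape] unfolding Lambda5_vertices_def by simp
qed

end
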